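(* Let $q\in\mathbb{C}\setminus\{0\}$ with $|q|\neq 1$ and let $A(z)$ be a meromorphic function. Suppose that the $q$-difference Riccati equation $$f(qz)=\frac{A(z)+f(z)}{1-(q-1)z f(z)}\qquad(\ast)$$ possesses three distinct meromorphic solutions $f_1(z), f_2(z)$ and $f_3(z)$. Then any meromorphic solution $f(z)$ of $(\ast)$ can be represented by $$f(z)=\frac{f_{1}(z)f_{3}(z)-f_{1}(z)f_{2}(z)+f_{1}(z)f_{2}(z)\phi(z)-f_{2}(z)f_{3}(z)\phi(z)}{f_{3}(z)-f_{2}(z)-f_{3}(z)\phi(z)+f_{1}(z)\phi(z)},\qquad(\ast\ast)$$ where $\phi(z)$ is a meromorphic function satisfying $\phi(qz)=\phi(z)$. Conversely, if for any meromorphic function $\phi(z)$ satisfying $\phi(qz)=\phi(z)$ we define a function $f(z)$ by $(\ast\ast)$, then $f(z)$ is a meromorphic solution of $(\ast)$.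
   Context: "Meromorphic" means meromorphic in the whole complex plane $\mathbb{C}$. A meromorphic solution of $(\ast)$ is a meromorphic function $f$ satisfying the equation.
   Formalization: The solution f = f_2 is excepted from the representation claim: putting f = f_2 in ( ** ) forces (f_1 − f_2)(f_3 − f_2) = 0, so no meromorphic φ represents it (it corresponds to φ ≡ ∞). *)

theory Defs
  imports "HOL-Complex_Analysis.Complex_Analysis"
begin

text \<open>
  The predicate \<^const>\<open>meromorphic_on\<close> puts no constraint on the values of a function on a
  set without accumulation points (for instance at its poles). Hence two functions
  represent the same meromorphic function on the plane iff they agree outside such a set, and
  all identities between meromorphic functions are understood in this sense. In the same way,
  two meromorphic functions are distinct iff they are not related by \<open>mero_eq\<close>.
\<close>

definition mero_eq :: "(complex \<Rightarrow> complex) \<Rightarrow> (complex \<Rightarrow> complex) \<Rightarrow> bool" where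
  "mero_eq f g \<longleftrightarrow> (\<forall>\<^sub>\<approx>z\<in>UNIV. f z = g z)"

text \<open>
  Division is total in HOL, so it is required explicitly that the denominator does not vanish
  identically.
\<close>

definition riccati_solution ::
  "complex \<Rightarrow> (complex \<Rightarrow> complex) \<Rightarrow> (complex \<Rightarrow> complex) \<Rightarrow> bool" where
  "riccati_solution q A f \<longleftrightarrow>
     f meromorphic_on UNIV \<and>
     \<not> mero_eq (\<lambda>z. 1 - (q - 1) * z * f z) (\<lambda>z. 0) \<and>
     mero_eq (\<lambda>z. f (q * z)) (\<lambda>z. (A z + f z) / (1 - (q - 1) * z * f z))"

definition q_periodic :: "complex \<Rightarrow> (complex \<Rightarrow> complex) \<Rightarrow> bool" where
  "q_periodic q \<phi> \<longleftrightarrow> \<phi> meromorphic_on UNIV \<and> mero_eq (\<lambda>z. \<phi> (q * z)) \<phi>"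

definition repr_num ::
  "(complex \<Rightarrow> complex) \<Rightarrow> (complex \<Rightarrow> complex) \<Rightarrow> (complex \<Rightarrow> complex) \<Rightarrow>
   (complex \<Rightarrow> complex) \<Rightarrow> complex \<Rightarrow> complex" where
  "repr_num f1 f2 f3 \<phi> z =
     f1 z * f3 z - f1 z * f2 z + f1 z * f2 z * \<phi> z - f2 z * f3 z * \<phi> z"

definition repr_den ::
  "(complex \<Rightarrow> complex) \<Rightarrow> (complex \<Rightarrow> complex) \<Rightarrow> (complex \<Rightarrow> complex) \<Rightarrow>
   (complex \<Rightarrow> complex) \<Rightarrow> complex \<Rightarrow> complex" where
  "repr_den f1 f2 f3 \<phi> z = f3 z - f2 z - f3 z * \<phi> z + f1 z * \<phi> z"

end

theory Submission
  imports Defs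
begin

text \<open>
  For fixed \<open>z\<close> the equation says that \<open>f (q * z)\<close> is the image of \<open>f z\<close> under the Moebius
  transformation with matrix \<open>[[1, A z], [- c, 1]]\<close>, where \<open>c = (q - 1) * z\<close>. The cross ratio
  \<open>\<phi> = (f - f1) * (f3 - f2) / ((f - f2) * (f3 - f1))\<close> is therefore q-periodic, and the
  representation formula is its inverse. The determinant of the matrix is not identically
  zero, since otherwise \<open>f1 (q * z)\<close> and \<open>f2 (q * z)\<close> would coincide. The denominator of the
  formula cannot vanish identically, because its values at \<open>z\<close> and \<open>q * z\<close> determine the numerator
  at \<open>z\<close>, and the two have no common zero where \<open>f1\<close>, \<open>f2\<close>, \<open>f3\<close> are distinct. All identities are
  checked at a point outside a sparse set, which suffices because a meromorphic function on the
  plane is either zero outside a sparse set or nonzero outside a sparse set.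
\<close>

text \<open>Turns a failed identity into a pointwise condition outside a sparse set, so that it can
  be combined with other such conditions at a single generic point.\<close>

lemma not_mero_eq_iff:
  assumes "f meromorphic_on UNIV" "g meromorphic_on UNIV"
  shows "\<not> mero_eq f g \<longleftrightarrow> (\<forall>\<^sub>\<approx>z\<in>UNIV. f z \<noteq> g z)"
proof
  assume "\<not> mero_eq f g"
  moreover have "(\<forall>\<^sub>\<approx>z\<in>UNIV. f z - g z = 0) \<or> (\<forall>\<^sub>\<approx>z\<in>UNIV. f z - g z \<noteq> 0)"
    by (intro meromorphic_imp_constant_or_avoid meromorphic_on_diff assms) auto
  ultimately show "\<forall>\<^sub>\<approx>z\<in>UNIV. f z \<noteq> g z"
    by (simp add: mero_eq_def)
next
  assume ne: "\<forall>\<^sub>\<approx>z\<in>UNIV. f z \<noteq> g z"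
  show "\<not> mero_eq f g"
  proof
    assume "mero_eq f g"
    then have "\<forall>\<^sub>\<approx>z\<in>(UNIV :: complex set). False"
      using ne unfolding mero_eq_def by eventually_elim simp
    then show False by simp
  qed
qed

text \<open>On an open set, cosparseness is a condition on punctured neighbourhoods, and
  multiplication by \<open>q\<close> is continuous and injective, so it respects them.\<close>

lemma eventually_cosparse_scale:
  fixes q :: complex
  assumes "q \<noteq> 0" and "\<forall>\<^sub>\<approx>z\<in>UNIV. P z"
  shows "\<forall>\<^sub>\<approx>z\<in>UNIV. P (q * z)"
proof -
  have "\<forall>\<^sub>F z in at w. P (q * z)" for w
  proof -
    have "filterlim (\<lambda>z. q * z) (at (q * w)) (at w)"
      by (rule filterlim_atI)
         (use assms(1) in \<open>auto intro!: tendsto_intros simp: eventually_at_filter\<close>)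
    moreover have "\<forall>\<^sub>F z in at (q * w). P z"
      using assms(2) by (rule eventually_cosparse_imp_eventually_at) simp
    ultimately show ?thesis
      by (rule eventually_compose_filterlim[rotated])
  qed
  then show ?thesis
    by (simp add: eventually_cosparse_open_eq)
qed

lemma eventually_cosparse_nonzero: "\<forall>\<^sub>\<approx>z\<in>UNIV. z \<noteq> (0 :: complex)"
  using eventually_not_in_cosparse[OF sparse_in_singleton[of 0 UNIV]] by simp

lemma riccati_solutionD:
  assumes "riccati_solution q A f"
  shows "f meromorphic_on UNIV"
    and "\<forall>\<^sub>\<approx>z\<in>UNIV. 1 - (q - 1) * z * f z \<noteq> 0 \<and>
           f (q * z) = (A z + f z) / (1 - (q - 1) * z * f z)"
proof -
  show mero: "f meromorphic_on UNIV"
    using assms by (simp add: riccati_solution_def)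
  have "(\<lambda>z. 1 - (q - 1) * z * f z) meromorphic_on UNIV"
    by (intro meromorphic_intros mero)
  then show "\<forall>\<^sub>\<approx>z\<in>UNIV. 1 - (q - 1) * z * f z \<noteq> 0 \<and>
      f (q * z) = (A z + f z) / (1 - (q - 1) * z * f z)"
    using assms not_mero_eq_iff[OF _ meromorphic_on_const]
    by (auto simp: riccati_solution_def mero_eq_def[of "\<lambda>z. f (q * z)"] intro: eventually_conj)
qed

text \<open>The factor \<open>1 + c * A\<close> is the determinant of the Moebius matrix.\<close>

lemma riccati_diff:
  fixes a b A c :: "'a :: field"
  assumes "1 - c * a \<noteq> 0" "1 - c * b \<noteq> 0"
  shows "(A + a) / (1 - c * a) - (A + b) / (1 - c * b) =
           (1 + c * A) * (a - b) / ((1 - c * a) * (1 - c * b))"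
  using assms by (simp add: diff_frac_eq) (simp add: algebra_simps)

text \<open>By \<open>riccati_diff\<close>, numerator and denominator both acquire the factor
  \<open>K\<close>, since each of the four points occurs once in either. If the denominator is 0,
  both sides are 0 by the convention for division.\<close>

lemma riccati_cross_ratio:
  fixes w f1 f2 f3 A c :: "'a :: field"
  assumes "1 - c * w \<noteq> 0" "1 - c * f1 \<noteq> 0" "1 - c * f2 \<noteq> 0" "1 - c * f3 \<noteq> 0"
    and "1 + c * A \<noteq> 0"
  defines "M \<equiv> \<lambda>x. (A + x) / (1 - c * x)"
  shows "(M w - M f1) * (M f3 - M f2) / ((M w - M f2) * (M f3 - M f1)) =
           (w - f1) * (f3 - f2) / ((w - f2) * (f3 - f1))"
proof -
  define u where "u = (\<lambda>x. 1 - c * x)"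
  define K where "K = (1 + c * A)^2 / (u w * u f1 * u f2 * u f3)"
  have u: "u w \<noteq> 0" "u f1 \<noteq> 0" "u f2 \<noteq> 0" "u f3 \<noteq> 0"
    using assms by (auto simp: u_def)
  have diff: "M x - M y = (1 + c * A) * (x - y) / (u x * u y)" if "u x \<noteq> 0" "u y \<noteq> 0" for x y
    using riccati_diff[of c x y A] that by (simp add: M_def u_def)
  have "K \<noteq> 0"
    using u assms(5) by (simp add: K_def)
  moreover have "(M w - M f1) * (M f3 - M f2) = K * ((w - f1) * (f3 - f2))"
    "(M w - M f2) * (M f3 - M f1) = K * ((w - f2) * (f3 - f1))"
    using u by (simp_all add: diff K_def power2_eq_square mult_ac)
  ultimately show ?thesis
    by simp
qed

text \<open>Only differences of solutions remain as coefficients, which is the form that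
  \<open>riccati_diff\<close> can transform.\<close>

lemma repr_den_alt: "repr_den f1 f2 f3 \<phi> z = (f3 z - f2 z) - \<phi> z * (f3 z - f1 z)"
  by (simp add: repr_den_def algebra_simps)

lemma repr_num_alt: "repr_num f1 f2 f3 \<phi> z = f1 z * (f3 z - f2 z) - \<phi> z * f2 z * (f3 z - f1 z)"
  by (simp add: repr_num_def algebra_simps)

text \<open>Cleared of fractions, the cross ratio equation is linear in \<open>w\<close>; the
  formula is its solution.\<close>

lemma repr_cross_ratio:
  assumes "\<phi> z = (w - f1 z) * (f3 z - f2 z) / ((w - f2 z) * (f3 z - f1 z))"
    and "w \<noteq> f2 z" "f1 z \<noteq> f2 z" "f1 z \<noteq> f3 z" "f2 z \<noteq> f3 z"
  shows "repr_den f1 f2 f3 \<phi> z \<noteq> 0"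
    and "w = repr_num f1 f2 f3 \<phi> z / repr_den f1 f2 f3 \<phi> z"
proof -
  have \<phi>: "\<phi> z * (f3 z - f1 z) * (w - f2 z) = (w - f1 z) * (f3 z - f2 z)"
    using assms by (simp add: mult.assoc mult.commute[of "f3 z - f1 z"])
  have "repr_den f1 f2 f3 \<phi> z * (w - f2 z) = (f3 z - f2 z) * (f1 z - f2 z)"
    unfolding repr_den_alt using \<phi> by (simp add: algebra_simps)
  then show nz: "repr_den f1 f2 f3 \<phi> z \<noteq> 0"
    using assms by auto
  have "w * repr_den f1 f2 f3 \<phi> z = repr_num f1 f2 f3 \<phi> z"
    unfolding repr_den_alt repr_num_alt using \<phi> by (simp add: algebra_simps)
  then show "w = repr_num f1 f2 f3 \<phi> z / repr_den f1 f2 f3 \<phi> z"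
    using nz by (simp add: field_simps)
qed

text \<open>Numerator and denominator are homogeneous coordinates: the Moebius matrix acts on the
  pair up to the scalar \<open>K\<close>. Without a quotient of the two, this also holds where
  \<open>repr_den\<close> vanishes.\<close>

lemma riccati_repr:
  fixes f1 f2 f3 \<phi> A :: "complex \<Rightarrow> complex" and q z c :: complex
  assumes step: "f1 (q * z) = (A z + f1 z) / (1 - c * f1 z)"
      "f2 (q * z) = (A z + f2 z) / (1 - c * f2 z)" "f3 (q * z) = (A z + f3 z) / (1 - c * f3 z)"
    and u: "1 - c * f1 z \<noteq> 0" "1 - c * f2 z \<noteq> 0" "1 - c * f3 z \<noteq> 0"
    and per: "\<phi> (q * z) = \<phi> z"
  defines "K \<equiv> (1 + c * A z) / ((1 - c * f1 z) * (1 - c * f2 z) * (1 - c * f3 z))"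
  shows "repr_den f1 f2 f3 \<phi> (q * z) = K * (repr_den f1 f2 f3 \<phi> z - c * repr_num f1 f2 f3 \<phi> z)"
    and "repr_num f1 f2 f3 \<phi> (q * z) = K * (A z * repr_den f1 f2 f3 \<phi> z + repr_num f1 f2 f3 \<phi> z)"
proof -
  define u1 u2 u3 where us: "u1 = 1 - c * f1 z" "u2 = 1 - c * f2 z" "u3 = 1 - c * f3 z"
  have nz: "u1 \<noteq> 0" "u2 \<noteq> 0" "u3 \<noteq> 0"
    using u by (simp_all add: us)
  have K: "K = (1 + c * A z) / (u1 * u2 * u3)"
    by (simp add: K_def us)
  have "f3 (q * z) - f2 (q * z) = (1 + c * A z) * (f3 z - f2 z) / (u3 * u2)"
    "f3 (q * z) - f1 (q * z) = (1 + c * A z) * (f3 z - f1 z) / (u3 * u1)"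
    unfolding step us using u by (simp_all add: riccati_diff)
  \<comment> \<open>Extending each fraction by the missing \<open>u1\<close> or \<open>u2\<close>
    gives both differences the common factor \<open>K\<close>.\<close>
  then have d: "f3 (q * z) - f2 (q * z) = K * u1 * (f3 z - f2 z)"
    "f3 (q * z) - f1 (q * z) = K * u2 * (f3 z - f1 z)"
    using nz by (simp_all add: K)
  show "repr_den f1 f2 f3 \<phi> (q * z) = K * (repr_den f1 f2 f3 \<phi> z - c * repr_num f1 f2 f3 \<phi> z)"
    unfolding repr_den_alt repr_num_alt d per by (simp add: us algebra_simps)
  have "f1 (q * z) * u1 = A z + f1 z" "f2 (q * z) * u2 = A z + f2 z"
    using nz by (simp_all add: step us)
  moreover have "repr_num f1 f2 f3 \<phi> (q * z) =
      K * ((f1 (q * z) * u1) * (f3 z - f2 z) - \<phi> z * (f2 (q * z) * u2) * (f3 z - f1 z))"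
    unfolding repr_num_alt d per by (simp add: algebra_simps)
  ultimately show
    "repr_num f1 f2 f3 \<phi> (q * z) = K * (A z * repr_den f1 f2 f3 \<phi> z + repr_num f1 f2 f3 \<phi> z)"
    unfolding repr_den_alt repr_num_alt by (simp add: algebra_simps)
qed

(* The solution f2 corresponds to the constant value infinity of \<phi> and is the only solution
   not obtained from a (finite) meromorphic \<phi>. *)
theorem theorem2p1:
  fixes q :: complex and A f1 f2 f3 :: "complex \<Rightarrow> complex"
  assumes "q \<noteq> 0" and "cmod q \<noteq> 1"
    and "A meromorphic_on UNIV"
    and "riccati_solution q A f1" and "riccati_solution q A f2" and "riccati_solution q A f3"
    and "\<not> mero_eq f1 f2" and "\<not> mero_eq f1 f3" and "\<not> mero_eq f2 f3"
  shows "(\<forall>f. riccati_solution q A f \<longrightarrow>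
            mero_eq f f2 \<or>
            (\<exists>\<phi>. q_periodic q \<phi> \<and>
                 \<not> mero_eq (repr_den f1 f2 f3 \<phi>) (\<lambda>z. 0) \<and>
                 mero_eq f (\<lambda>z. repr_num f1 f2 f3 \<phi> z / repr_den f1 f2 f3 \<phi> z))) \<and>
         (\<forall>\<phi>. q_periodic q \<phi> \<longrightarrow>
            \<not> mero_eq (repr_den f1 f2 f3 \<phi>) (\<lambda>z. 0) \<and>
            riccati_solution q A (\<lambda>z. repr_num f1 f2 f3 \<phi> z / repr_den f1 f2 f3 \<phi> z))"
proof (intro conjI allI impI)
  note f1 = riccati_solutionD[OF assms(4)]
  note f2 = riccati_solutionD[OF assms(5)]
  note f3 = riccati_solutionD[OF assms(6)]
  have ne: "\<forall>\<^sub>\<approx>z\<in>UNIV. f1 z \<noteq> f2 z" "\<forall>\<^sub>\<approx>z\<in>UNIV. f1 z \<noteq> f3 z" "\<forall>\<^sub>\<approx>z\<in>UNIV. f2 z \<noteq> f3 z"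
    using assms(7-9) not_mero_eq_iff f1(1) f2(1) f3(1) by blast+
  have "q \<noteq> 1"
    using assms(2) by auto
  have c: "\<forall>\<^sub>\<approx>z\<in>UNIV. (q - 1) * z \<noteq> 0"
    using eventually_cosparse_nonzero by eventually_elim (use \<open>q \<noteq> 1\<close> in simp)
  have det: "\<forall>\<^sub>\<approx>z\<in>UNIV. 1 + (q - 1) * z * A z \<noteq> 0"
    using f1(2) f2(2) eventually_cosparse_scale[OF assms(1) ne(1)]
  proof eventually_elim
    case (elim z)
    then show ?case
      using riccati_diff[of "(q - 1) * z" "f1 z" "f2 z" "A z"] by auto
  qed
  {
    fix f assume "riccati_solution q A f"
    note f = riccati_solutionD[OF this]
    show "mero_eq f f2 \<or>
            (\<exists>\<phi>. q_periodic q \<phi> \<and>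
                 \<not> mero_eq (repr_den f1 f2 f3 \<phi>) (\<lambda>z. 0) \<and>
                 mero_eq f (\<lambda>z. repr_num f1 f2 f3 \<phi> z / repr_den f1 f2 f3 \<phi> z))"
    proof (rule disj_imp[THEN iffD2], rule impI)
      assume "\<not> mero_eq f f2"
      then have f_ne: "\<forall>\<^sub>\<approx>z\<in>UNIV. f z \<noteq> f2 z"
        using not_mero_eq_iff f(1) f2(1) by blast
      define \<phi> where "\<phi> = (\<lambda>z. (f z - f1 z) * (f3 z - f2 z) / ((f z - f2 z) * (f3 z - f1 z)))"
      have \<phi>: "\<phi> meromorphic_on UNIV"
        unfolding \<phi>_def by (intro meromorphic_intros f f1 f2 f3)
      have "\<forall>\<^sub>\<approx>z\<in>UNIV. \<phi> (q * z) = \<phi> z"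
        using f(2) f1(2) f2(2) f3(2) det
      proof eventually_elim
        case (elim z)
        then show ?case
          using riccati_cross_ratio[of "(q - 1) * z" "f z" "f1 z" "f2 z" "f3 z" "A z"]
          by (simp add: \<phi>_def)
      qed
      with \<phi> have "q_periodic q \<phi>"
        by (simp add: q_periodic_def mero_eq_def)
      moreover have "\<forall>\<^sub>\<approx>z\<in>UNIV. repr_den f1 f2 f3 \<phi> z \<noteq> 0 \<and>
          f z = repr_num f1 f2 f3 \<phi> z / repr_den f1 f2 f3 \<phi> z"
        using f_ne ne
        by eventually_elim (intro conjI repr_cross_ratio; simp add: \<phi>_def)
      then have "\<forall>\<^sub>\<approx>z\<in>UNIV. repr_den f1 f2 f3 \<phi> z \<noteq> 0"
        "mero_eq f (\<lambda>z. repr_num f1 f2 f3 \<phi> z / repr_den f1 f2 f3 \<phi> z)"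
        unfolding mero_eq_def by (auto elim: eventually_mono)
      moreover have "repr_den f1 f2 f3 \<phi> meromorphic_on UNIV"
        unfolding repr_den_def by (intro meromorphic_intros f1 f2 f3 \<phi>)
      ultimately show "\<exists>\<phi>. q_periodic q \<phi> \<and> \<not> mero_eq (repr_den f1 f2 f3 \<phi>) (\<lambda>z. 0) \<and>
          mero_eq f (\<lambda>z. repr_num f1 f2 f3 \<phi> z / repr_den f1 f2 f3 \<phi> z)"
        using not_mero_eq_iff[OF _ meromorphic_on_const] by blast
    qed
  next
    fix \<phi> assume "q_periodic q \<phi>"
    then have \<phi>: "\<phi> meromorphic_on UNIV" and per: "\<forall>\<^sub>\<approx>z\<in>UNIV. \<phi> (q * z) = \<phi> z"
      by (auto simp: q_periodic_def mero_eq_def)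
    let ?N = "repr_num f1 f2 f3 \<phi>" and ?D = "repr_den f1 f2 f3 \<phi>"
    have mero: "?N meromorphic_on UNIV" "?D meromorphic_on UNIV"
      unfolding repr_num_def repr_den_def by (intro meromorphic_intros f1 f2 f3 \<phi>)+
    define K where "K = (\<lambda>z. (1 + (q - 1) * z * A z) /
      ((1 - (q - 1) * z * f1 z) * (1 - (q - 1) * z * f2 z) * (1 - (q - 1) * z * f3 z)))"
    have step: "\<forall>\<^sub>\<approx>z\<in>UNIV. K z \<noteq> 0 \<and> ?D (q * z) = K z * (?D z - (q - 1) * z * ?N z) \<and>
        ?N (q * z) = K z * (A z * ?D z + ?N z)"
      using f1(2) f2(2) f3(2) per det
    proof eventually_elim
      case (elim z)
      then show ?case
        using riccati_repr[of f1 q z A "(q - 1) * z" f2 f3 \<phi>] by (simp add: K_def)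
    qed
    show "\<not> mero_eq ?D (\<lambda>z. 0)"
    proof
      assume "mero_eq ?D (\<lambda>z. 0)"
      then have D: "\<forall>\<^sub>\<approx>z\<in>UNIV. ?D z = 0"
        by (simp add: mero_eq_def)
      have "\<forall>\<^sub>\<approx>z\<in>(UNIV :: complex set). False"
        using D eventually_cosparse_scale[OF assms(1) D] step c ne
      proof eventually_elim
        case (elim z)
        \<comment> \<open>The recursion for \<open>?D\<close> reduces to
          \<open>K z * (q - 1) * z * ?N z = 0\<close>, where the factors before \<open>?N z\<close>
          are nonzero.\<close>
        then have "?N z = 0"
          by simp
        \<comment> \<open>This identity excludes a common zero of \<open>?N\<close> and
          \<open>?D\<close> where the solutions differ.\<close>
        moreover have "?N z = (f1 z - f2 z) * (f3 z - f2 z) + f2 z * ?D z"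
          unfolding repr_num_alt repr_den_alt by (simp add: algebra_simps)
        ultimately show False
          using elim by simp
      qed
      then show False by simp
    qed
    then have D: "\<forall>\<^sub>\<approx>z\<in>UNIV. ?D z \<noteq> 0"
      using not_mero_eq_iff[OF mero(2) meromorphic_on_const] by simp
    have "\<forall>\<^sub>\<approx>z\<in>UNIV. 1 - (q - 1) * z * (?N z / ?D z) \<noteq> 0 \<and>
        ?N (q * z) / ?D (q * z) = (A z + ?N z / ?D z) / (1 - (q - 1) * z * (?N z / ?D z))"
      \<comment> \<open>By \<open>step\<close>, \<open>?D (q * z)\<close> being nonzero forces
        \<open>?D z - (q - 1) * z * ?N z\<close> to be nonzero, which is the Riccati denominator
        times \<open>?D z\<close>.\<close>
      using D eventually_cosparse_scale[OF assms(1) D] step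
    proof eventually_elim
      case (elim z)
      then have "1 - (q - 1) * z * (?N z / ?D z) = (?D z - (q - 1) * z * ?N z) / ?D z"
        "A z + ?N z / ?D z = (A z * ?D z + ?N z) / ?D z"
        by (simp_all add: field_simps)
      then show ?case
        using elim by simp
    qed
    then have "\<forall>\<^sub>\<approx>z\<in>UNIV. 1 - (q - 1) * z * (?N z / ?D z) \<noteq> 0"
      "mero_eq (\<lambda>z. ?N (q * z) / ?D (q * z))
        (\<lambda>z. (A z + ?N z / ?D z) / (1 - (q - 1) * z * (?N z / ?D z)))"
      unfolding mero_eq_def by (auto elim: eventually_mono)
    moreover have "(\<lambda>z. 1 - (q - 1) * z * (?N z / ?D z)) meromorphic_on UNIV"
      by (intro meromorphic_intros mero)
    ultimately show "riccati_solution q A (\<lambda>z. ?N z / ?D z)"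
      unfolding riccati_solution_def
      using not_mero_eq_iff[OF _ meromorphic_on_const] meromorphic_on_divide[OF mero] by blast
  }
qed

end
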